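(* There exists $\sigma_0>0$ such that for every $\sigma$ with $0<\sigma<\sigma_0$ the Robin spectrum of the unit square has no spectral multiplicities other than the trivial ones $\Lambda_{n,m}(\sigma)=\Lambda_{m,n}(\sigma)$; that is, if $n,m,n',m'\ge 0$ are integers with $\Lambda_{n,m}(\sigma)=\Lambda_{n',m'}(\sigma)$, then $(n',m')=(n,m)$ or $(n',m')=(m,n)$.
   Context: For an integer $n\ge 0$ and $\sigma>0$, $k_n(\sigma)$ denotes the unique solution $k\in(n\pi,(n+1)\pi)$ of the secular equation $\tan(k)=\frac{2\sigma k}{k^2-\sigma^2}$ (read in cross-multiplied form, $(k^2-\sigma^2)\sin k=2\sigma k\cos k$, when $k=\sigma$); set $k_n(0)=n\pi$. The numbers $k_n(\sigma)^2$, $n\ge0$, are the eigenvalues of $-u''=k^2u$ on $[0,1]$ with Robin boundary conditions $-u'(0)+\sigma u(0)=0$, $u'(1)+\sigma u(1)=0$. The Robin eigenvalues of the unit square $[0,1]^2$ (i.e. of $-\Delta f=\lambda f$ with $\frac{\partial f}{\partial n}+\sigma f=0$ on the boundary, $\frac{\partial}{\partial n}$ being the outward normal derivative) are $\Lambda_{n,m}(\sigma)=k_n(\sigma)^2+k_m(\sigma)^2$, $n,m\ge 0$, listed with multiplicity by the pairs $(n,m)$. *)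

theory Defs
  imports Complex_Main
begin

text \<open>
  The secular equation \<open>tan k = 2\<sigma>k / (k\<^sup>2 - \<sigma>\<^sup>2)\<close>. For \<open>k = \<sigma>\<close>, where the right-hand side has a
  pole, it is read in cross-multiplied form. For \<open>k \<noteq> \<sigma>\<close> and \<open>k, \<sigma> > 0\<close> the library convention
  \<open>tan k = 0\<close> at the poles of \<open>tan\<close> adds no solutions, since there the right-hand side is nonzero;
  see \<open>robin_secular_iff\<close>.
\<close>

definition robin_secular :: "real \<Rightarrow> real \<Rightarrow> bool" where
  "robin_secular \<sigma> k \<longleftrightarrow>
     (if k = \<sigma> then (k\<^sup>2 - \<sigma>\<^sup>2) * sin k = 2 * \<sigma> * k * cos k
      else tan k = 2 * \<sigma> * k / (k\<^sup>2 - \<sigma>\<^sup>2))"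

text \<open>Only meaningful for \<open>\<sigma> \<ge> 0\<close>; \<open>robin_k_unique\<close> justifies the definite description.\<close>

definition robin_k :: "nat \<Rightarrow> real \<Rightarrow> real" where
  "robin_k n \<sigma> =
     (if \<sigma> = 0 then real n * pi
      else (THE k. real n * pi < k \<and> k < (real n + 1) * pi \<and> robin_secular \<sigma> k))"

definition robin_square_eigenvalue :: "nat \<Rightarrow> nat \<Rightarrow> real \<Rightarrow> real" where
  "robin_square_eigenvalue n m \<sigma> = (robin_k n \<sigma>)\<^sup>2 + (robin_k m \<sigma>)\<^sup>2"

lemma robin_secular_iff:
  assumes "\<sigma> > 0" "k > 0"
  shows "robin_secular \<sigma> k \<longleftrightarrow> (k\<^sup>2 - \<sigma>\<^sup>2) * sin k = 2 * \<sigma> * k * cos k"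
proof (cases "k = \<sigma>")
  case True
  then show ?thesis by (simp add: robin_secular_def)
next
  case False
  have "k\<^sup>2 - \<sigma>\<^sup>2 \<noteq> 0"
    using False assms by (simp add: power2_eq_iff_nonneg)
  show ?thesis
  proof (cases "cos k = 0")
    case True
    then have "sin k \<noteq> 0"
      using sin_cos_squared_add[of k] by auto
    with True False \<open>k\<^sup>2 - \<sigma>\<^sup>2 \<noteq> 0\<close> assms show ?thesis
      by (simp add: robin_secular_def tan_def)
  next
    case c: False
    with False \<open>k\<^sup>2 - \<sigma>\<^sup>2 \<noteq> 0\<close> show ?thesis
      by (simp add: robin_secular_def tan_def field_simps)
  qed
qed

lemma robin_k_unique:
  assumes "\<sigma> > 0"
  shows "\<exists>!k. real n * pi < k \<and> k < (real n + 1) * pi \<and> robin_secular \<sigma> k"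
proof -
  define N where "N = real n * pi"
  define f where "f t = ((t + N)\<^sup>2 - \<sigma>\<^sup>2) * sin t - 2 * \<sigma> * (t + N) * cos t" for t
  have N0: "N \<ge> 0" by (simp add: N_def)
  have sN: "sin (t + N) = (-1) ^ n * sin t" and cN: "cos (t + N) = (-1) ^ n * cos t" for t
    by (simp_all add: N_def sin_add cos_add)
  have sec: "robin_secular \<sigma> (t + N) \<longleftrightarrow> f t = 0" if "t > 0" for t
  proof -
    have "robin_secular \<sigma> (t + N) \<longleftrightarrow>
        (-1) ^ n * (((t + N)\<^sup>2 - \<sigma>\<^sup>2) * sin t) = (-1) ^ n * (2 * \<sigma> * (t + N) * cos t)"
      using that N0 by (subst robin_secular_iff[OF assms]) (simp_all add: sN cN mult_ac)
    then show ?thesis by (simp add: f_def)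
  qed
  have cont: "continuous_on A f" for A
    unfolding f_def by (intro continuous_intros)
  have "\<exists>a. 0 < a \<and> a < pi \<and> f a < 0"
  proof (cases "n = 0")
    case True
    define a where "a = min (\<sigma> / 2) (pi / 4)"
    have a: "0 < a" "a < pi / 2" "a < \<sigma>" using assms by (auto simp: a_def min_def)
    then have "sin a > 0" "cos a > 0" by (auto intro!: sin_gt_zero cos_gt_zero)
    moreover have "a\<^sup>2 - \<sigma>\<^sup>2 < 0" using a by (simp add: power_strict_mono)
    ultimately have "(a\<^sup>2 - \<sigma>\<^sup>2) * sin a < 0" "2 * \<sigma> * a * cos a > 0"
      using a assms by (auto intro: mult_neg_pos)
    then have "f a < 0" using True by (simp add: f_def N_def)
    then show ?thesis using a by auto
  next
    case False
    then have "f 0 < 0" using assms by (simp add: f_def N_def)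
    moreover have "isCont f 0" unfolding f_def by (intro continuous_intros)
    ultimately have "eventually (\<lambda>t. f t < 0) (at_right 0)"
      by (metis filterlim_at_split isCont_def order_tendstoD(2))
    moreover have "eventually (\<lambda>t. t \<in> {0<..<pi}) (at_right 0)"
      by (rule eventually_at_right_real) simp
    ultimately have "eventually (\<lambda>t. f t < 0 \<and> t \<in> {0<..<pi}) (at_right 0)"
      by (rule eventually_conj)
    then show ?thesis
      using eventually_happens'[OF trivial_limit_at_right_real] by fastforce
  qed
  then obtain a where a: "0 < a" "a < pi" "f a < 0" by blast
  have fpi: "f pi > 0" using assms N0 by (simp add: f_def add_pos_nonneg)
  obtain t where t: "a \<le> t" "t \<le> pi" "f t = 0"
    using IVT'[of f a 0 pi] a fpi cont by fastforce
  then have "t < pi" using fpi by (cases "t = pi") auto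
  then have ex: "N < t + N \<and> t + N < N + pi \<and> robin_secular \<sigma> (t + N)"
    using t a sec by auto
  have uniq: False if "0 < x" "x < y" "y < pi" "f x = 0" "f y = 0" for x y
  proof -
    define X Y where "X = x + N" and "Y = y + N"
    have XY: "0 < X" "X < Y" using that N0 by (auto simp: X_def Y_def)
    have s: "sin x > 0" "sin y > 0" "sin (y - x) > 0"
      using that by (auto intro!: sin_gt_zero)
    have ex: "(X\<^sup>2 - \<sigma>\<^sup>2) * sin x = 2 * \<sigma> * X * cos x"
      and ey: "(Y\<^sup>2 - \<sigma>\<^sup>2) * sin y = 2 * \<sigma> * Y * cos y"
      using that by (auto simp: f_def X_def Y_def)
    have "2 * \<sigma> * X * Y * sin (y - x) = X * sin x * ((\<sigma>\<^sup>2 - Y\<^sup>2) * sin y) + Y * sin y * ((X\<^sup>2 - \<sigma>\<^sup>2) * sin x)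
      + X * sin x * ((Y\<^sup>2 - \<sigma>\<^sup>2) * sin y + 2 * \<sigma> * Y * (- cos y))
      + Y * sin y * (2 * \<sigma> * X * cos x - (X\<^sup>2 - \<sigma>\<^sup>2) * sin x)"
      by (simp add: sin_diff algebra_simps)
    also have "\<dots> = X * sin x * ((\<sigma>\<^sup>2 - Y\<^sup>2) * sin y) + Y * sin y * ((X\<^sup>2 - \<sigma>\<^sup>2) * sin x)"
      using ex ey by simp
    also have "\<dots> = - ((Y - X) * (X * Y + \<sigma>\<^sup>2) * (sin x * sin y))"
      by (simp add: algebra_simps power2_eq_square)
    also have "\<dots> < 0"
      using XY s assms by (simp add: add_pos_pos)
    finally show False using XY s assms by (simp add: mult_less_0_iff)
  qed
  show ?thesis
  proof (rule ex1I[of _ "t + N"])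
    show "real n * pi < t + N \<and> t + N < (real n + 1) * pi \<and> robin_secular \<sigma> (t + N)"
      using ex by (simp add: N_def algebra_simps)
  next
    fix k assume k: "real n * pi < k \<and> k < (real n + 1) * pi \<and> robin_secular \<sigma> k"
    define y where "y = k - N"
    have "0 < y" "y < pi" "f y = 0"
      using k sec[of y] by (auto simp: y_def N_def algebra_simps)
    moreover have "0 < t" using a t by simp
    ultimately have "y = t"
      using uniq[of y t] uniq[of t y] t \<open>t < pi\<close> by (cases y t rule: linorder_cases) auto
    then show "k = t + N" by (simp add: y_def)
  qed
qed

end

theory Submission
  imports Defs
begin

text \<open>
  Write \<open>\<theta>(k) = k - 2 arctan (\<sigma>/k)\<close> for the phase. The secular equation on
  \<open>(n\<pi>, (n+1)\<pi>)\<close> says exactly \<open>\<theta>(k) = n\<pi>\<close>, so the squared phase maps the one-dimensional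
  Robin eigenvalue \<open>k\<^sub>n\<^sup>2\<close> to the Neumann eigenvalue \<open>(n\<pi>)\<^sup>2\<close>. Two properties of this map
  suffice.

  First, it is uniformly close to the identity: \<open>0 \<le> k\<^sub>n\<^sup>2 - (n\<pi>)\<^sup>2 \<le> 4\<sigma>\<close>
  (\<open>robin_k_square_bounds\<close>). For \<open>8\<sigma> < \<pi>\<^sup>2\<close> an eigenvalue of the square therefore determines the
  integer \<open>n\<^sup>2 + m\<^sup>2\<close>, and a multiplicity can only occur between two representations of
  the same integer as a sum of two squares.

  Second, \<open>u \<mapsto> \<theta>(\<surd>u)\<^sup>2\<close> is strictly convex on \<open>u > 0\<close>, for every \<open>\<sigma> > 0\<close>
  (\<open>phase_slope_strict_mono\<close>). Of two distinct representations
  \<open>n\<^sup>2 + m\<^sup>2 = n'\<^sup>2 + m'\<^sup>2\<close>, one is nested inside the other, say \<open>m < m' \<le> n' < n\<close>. If also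
  \<open>k\<^sub>n\<^sup>2 + k\<^sub>m\<^sup>2 = k\<^sub>n\<^sub>'\<^sup>2 + k\<^sub>m\<^sub>'\<^sup>2\<close>, then the convex map has
  equal increments over two intervals of equal length, one to the right of the other, which strict
  convexity forbids (\<open>phase_square_increment_less\<close>).
\<close>

section \<open>Convexity of the squared phase\<close>

definition phase :: "real \<Rightarrow> real \<Rightarrow> real" where
  "phase \<sigma> k = k - 2 * arctan (\<sigma> / k)"

text \<open>The derivative of \<open>u \<mapsto> \<theta>(\<surd>u)\<^sup>2\<close>, written in terms of \<open>k = \<surd>u\<close>.\<close>

definition phase_slope :: "real \<Rightarrow> real \<Rightarrow> real" where
  "phase_slope \<sigma> k = phase \<sigma> k * (1 + 2 * \<sigma> / (k\<^sup>2 + \<sigma>\<^sup>2)) / k"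

text \<open>Both bounds come from one mean value: the slope \<open>1 / (1 + z\<^sup>2)\<close> of \<open>arctan\<close> at \<open>0 < z < t\<close>.\<close>

lemma arctan_bounds:
  assumes "0 < t"
  shows "t / (1 + t\<^sup>2) \<le> arctan t" "arctan t \<le> t"
proof -
  obtain z where z: "0 < z" "z < t" "arctan t = t * inverse (1 + z\<^sup>2)"
    using MVT2[OF assms, of arctan "\<lambda>z. inverse (1 + z\<^sup>2)"] DERIV_arctan by auto
  have "z\<^sup>2 \<le> t\<^sup>2" using z by (simp add: power_mono)
  then have "inverse (1 + t\<^sup>2) \<le> inverse (1 + z\<^sup>2)"
    by (intro le_imp_inverse_le) (auto simp: add_pos_nonneg)
  then show "t / (1 + t\<^sup>2) \<le> arctan t"
    using assms z(3) by (simp add: divide_inverse)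
  have "inverse (1 + z\<^sup>2) \<le> 1" by (simp add: inverse_le_1_iff)
  then show "arctan t \<le> t"
    using assms z(3) by (simp add: mult_left_le)
qed

lemma phase_le:
  assumes "0 < \<sigma>" "0 < k"
  shows "phase \<sigma> k \<le> k * (1 - 2 * \<sigma> / (k\<^sup>2 + \<sigma>\<^sup>2))"
proof -
  have "(\<sigma> / k) / (1 + (\<sigma> / k)\<^sup>2) = k * \<sigma> / (k\<^sup>2 + \<sigma>\<^sup>2)"
    using assms by (simp add: field_simps power2_eq_square add_pos_pos)
  then have "k * \<sigma> / (k\<^sup>2 + \<sigma>\<^sup>2) \<le> arctan (\<sigma> / k)"
    using arctan_bounds(1)[of "\<sigma> / k"] assms by simp
  moreover have "k * (1 - 2 * \<sigma> / (k\<^sup>2 + \<sigma>\<^sup>2)) = k - 2 * (k * \<sigma> / (k\<^sup>2 + \<sigma>\<^sup>2))"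
    by (simp add: right_diff_distrib)
  ultimately show ?thesis by (simp add: phase_def)
qed

lemma phase_has_derivative:
  assumes "0 < \<sigma>" "0 < k"
  shows "(phase \<sigma> has_real_derivative 1 + 2 * \<sigma> / (k\<^sup>2 + \<sigma>\<^sup>2)) (at k)"
proof -
  have "(phase \<sigma> has_real_derivative 1 - 2 * (inverse (1 + (\<sigma> / k)\<^sup>2) * (- \<sigma> / k\<^sup>2))) (at k)"
    unfolding phase_def using assms
    by (auto intro!: derivative_eq_intros simp: field_simps power2_eq_square)
  moreover have "1 - 2 * (inverse (1 + (\<sigma> / k)\<^sup>2) * (- \<sigma> / k\<^sup>2)) = 1 + 2 * \<sigma> / (k\<^sup>2 + \<sigma>\<^sup>2)"
  proof -
    have "1 + (\<sigma> / k)\<^sup>2 = (k\<^sup>2 + \<sigma>\<^sup>2) / k\<^sup>2"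
      using assms by (simp add: field_simps)
    then show ?thesis using assms by (simp add: field_simps)
  qed
  ultimately show ?thesis by simp
qed

lemma phase_square_has_derivative:
  assumes "0 < \<sigma>" "0 < u"
  shows "((\<lambda>u. (phase \<sigma> (sqrt u))\<^sup>2) has_real_derivative phase_slope \<sigma> (sqrt u)) (at u)"
proof -
  have "((\<lambda>u. phase \<sigma> (sqrt u)) has_real_derivative
      (1 + 2 * \<sigma> / ((sqrt u)\<^sup>2 + \<sigma>\<^sup>2)) * (inverse (sqrt u) / 2)) (at u)"
    using assms by (intro DERIV_chain2[OF phase_has_derivative DERIV_real_sqrt]) auto
  from DERIV_power[OF this, of 2] show ?thesis
    by (rule DERIV_cong) (simp add: phase_slope_def divide_simps)
qed

text \<open>
  With \<open>w = 2\<sigma> / (k\<^sup>2 + \<sigma>\<^sup>2)\<close> one has \<open>\<theta>' = 1 + w\<close>, so the slope is \<open>\<theta> (1 + w) / k\<close> and the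
  sign of its derivative is that of \<open>(1 + w)\<^sup>2 k - \<theta> (1 + w + e)\<close>, where \<open>e = - k w'\<close> lies
  between \<open>0\<close> and \<open>2w\<close>. The bound \<open>\<theta> \<le> k (1 - w)\<close> reduces positivity to
  \<open>(1 - w) (1 + w + e) \<le> 1 - w\<^sup>2 + 2w < (1 + w)\<^sup>2\<close>.
\<close>

lemma phase_slope_strict_mono:
  assumes "0 < \<sigma>" "0 < a" "a < b"
  shows "phase_slope \<sigma> a < phase_slope \<sigma> b"
proof (rule DERIV_pos_imp_increasing[OF assms(3)])
  fix k assume "a \<le> k" "k \<le> b"
  then have k: "0 < k" using assms by simp
  define s where "s = k\<^sup>2 + \<sigma>\<^sup>2"
  define w where "w = 2 * \<sigma> / s"
  define e where "e = k * (2 * \<sigma> * (2 * k) / s\<^sup>2)"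
  define D where "D = ((1 + w) * (1 + w) * k - phase \<sigma> k * (1 + w + e)) / k\<^sup>2"
  have s: "0 < s" using assms k by (simp add: s_def add_pos_pos)
  have w: "0 < w" using assms s by (simp add: w_def)
  have e0: "0 \<le> e" using assms k by (simp add: e_def)
  have "e = 2 * w * (k\<^sup>2 / s)"
    using s by (simp add: e_def w_def field_simps power2_eq_square)
  also have "\<dots> \<le> 2 * w * 1"
    using w s by (intro mult_left_mono) (auto simp: s_def)
  finally have e2: "e \<le> 2 * w" by simp
  have dw: "((\<lambda>k. 1 + 2 * \<sigma> / (k\<^sup>2 + \<sigma>\<^sup>2)) has_real_derivative - (2 * \<sigma> * (2 * k) / s\<^sup>2)) (at k)"
    using s by (auto intro!: derivative_eq_intros simp: s_def power2_eq_square)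
  have dp: "(phase \<sigma> has_real_derivative 1 + w) (at k)"
    using phase_has_derivative[OF assms(1) k] by (simp only: w_def s_def)
  have "((\<lambda>k. phase \<sigma> k * (1 + 2 * \<sigma> / (k\<^sup>2 + \<sigma>\<^sup>2)) / k) has_real_derivative D) (at k)"
  proof (rule DERIV_cong[OF DERIV_divide[OF DERIV_mult[OF dp dw] DERIV_ident]])
    show "k \<noteq> 0" using k by simp
    have "1 + 2 * \<sigma> / (k\<^sup>2 + \<sigma>\<^sup>2) = 1 + w" by (simp only: w_def s_def)
    moreover have "((1 + w) * (1 + w) + - c * p) * k - p * (1 + w) * 1
        = (1 + w) * (1 + w) * k - p * (1 + w + k * c)" for c p
      by (simp add: algebra_simps)
    ultimately show "(((1 + w) * (1 + 2 * \<sigma> / (k\<^sup>2 + \<sigma>\<^sup>2))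
          + - (2 * \<sigma> * (2 * k) / s\<^sup>2) * phase \<sigma> k) * k
        - phase \<sigma> k * (1 + 2 * \<sigma> / (k\<^sup>2 + \<sigma>\<^sup>2)) * 1) / (k * k) = D"
      by (simp only: D_def e_def power2_eq_square[of k])
  qed
  then have "(phase_slope \<sigma> has_real_derivative D) (at k)"
    by (simp only: phase_slope_def[abs_def])
  moreover have "0 < D"
  proof -
    have "phase \<sigma> k * (1 + w + e) \<le> k * (1 - w) * (1 + w + e)"
      using phase_le[OF assms(1) k] w e0 by (intro mult_right_mono) (auto simp: w_def s_def)
    also have "\<dots> = k * (1 + e - w * w - w * e)"
      by (simp add: algebra_simps)
    also have "\<dots> < k * ((1 + w) * (1 + w))"
    proof (rule mult_strict_left_mono[OF _ k])
      have "0 < w * w" "0 \<le> w * e" using w e0 by auto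
      then show "1 + e - w * w - w * e < (1 + w) * (1 + w)"
        using e2 by (simp add: algebra_simps)
    qed
    finally show ?thesis using k by (simp add: D_def mult_ac)
  qed
  ultimately show "\<exists>y. (phase_slope \<sigma> has_real_derivative y) (at k) \<and> 0 < y" by blast
qed

text \<open>
  The mean value theorem turns the growth of the slope into strict convexity in the variable
  \<open>u = k\<^sup>2\<close>: of two non-overlapping intervals of the same length, the right one has the larger increment.
\<close>

lemma phase_square_increment_less:
  assumes "0 < \<sigma>" "0 < a" "a < b" "b \<le> c" "c < d" "b\<^sup>2 - a\<^sup>2 = d\<^sup>2 - c\<^sup>2"
  shows "(phase \<sigma> b)\<^sup>2 - (phase \<sigma> a)\<^sup>2 < (phase \<sigma> d)\<^sup>2 - (phase \<sigma> c)\<^sup>2"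
proof -
  have mvt: "\<exists>z. x\<^sup>2 < z \<and> z < y\<^sup>2 \<and>
      (phase \<sigma> y)\<^sup>2 - (phase \<sigma> x)\<^sup>2 = (y\<^sup>2 - x\<^sup>2) * phase_slope \<sigma> (sqrt z)"
    if "0 < x" "x < y" for x y
  proof -
    have "x\<^sup>2 < y\<^sup>2" using that by (simp add: power_strict_mono)
    moreover have "((\<lambda>u. (phase \<sigma> (sqrt u))\<^sup>2) has_real_derivative phase_slope \<sigma> (sqrt u)) (at u)"
      if "x\<^sup>2 \<le> u" for u
      using that \<open>0 < x\<close> assms(1)
      by (intro phase_square_has_derivative) (auto intro: less_le_trans[of 0 "x\<^sup>2"])
    ultimately show ?thesis
      using MVT2[of "x\<^sup>2" "y\<^sup>2" "\<lambda>u. (phase \<sigma> (sqrt u))\<^sup>2" "\<lambda>u. phase_slope \<sigma> (sqrt u)"] that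
      by auto
  qed
  obtain y where y: "a\<^sup>2 < y" "y < b\<^sup>2"
      "(phase \<sigma> b)\<^sup>2 - (phase \<sigma> a)\<^sup>2 = (b\<^sup>2 - a\<^sup>2) * phase_slope \<sigma> (sqrt y)"
    using mvt[of a b] assms by blast
  obtain z where z: "c\<^sup>2 < z" "z < d\<^sup>2"
      "(phase \<sigma> d)\<^sup>2 - (phase \<sigma> c)\<^sup>2 = (d\<^sup>2 - c\<^sup>2) * phase_slope \<sigma> (sqrt z)"
    using mvt[of c d] assms by force
  have "b\<^sup>2 \<le> c\<^sup>2" using assms by (simp add: power_mono)
  then have "y < z" using y z by linarith
  moreover have "0 < y" using y(1) zero_le_power2[of a] by linarith
  ultimately have "phase_slope \<sigma> (sqrt y) < phase_slope \<sigma> (sqrt z)"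
    using phase_slope_strict_mono[OF assms(1), of "sqrt y" "sqrt z"] by simp
  moreover have "0 < b\<^sup>2 - a\<^sup>2" using y by linarith
  ultimately show ?thesis using y(3) z(3) assms(6) by simp
qed

section \<open>One-dimensional Robin eigenvalues\<close>

lemma robin_k_bounds_and_secular:
  assumes "0 < \<sigma>"
  shows "real n * pi < robin_k n \<sigma>" "robin_k n \<sigma> < (real n + 1) * pi"
    "robin_secular \<sigma> (robin_k n \<sigma>)"
  using theI'[OF robin_k_unique[OF assms, of n]] assms by (auto simp: robin_k_def)

lemma robin_k_pos:
  assumes "0 < \<sigma>"
  shows "0 < robin_k n \<sigma>"
  by (rule le_less_trans[OF _ robin_k_bounds_and_secular(1)[OF assms]]) simp

lemma robin_k_strict_mono:
  assumes "0 < \<sigma>" "m < n"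
  shows "robin_k m \<sigma> < robin_k n \<sigma>"
proof -
  have "(real m + 1) * pi \<le> real n * pi"
    using assms(2) by (intro mult_right_mono) auto
  then show ?thesis
    using robin_k_bounds_and_secular[OF assms(1)] by (meson le_less_trans less_trans)
qed

text \<open>
  The vector \<open>(k\<^sup>2 - \<sigma>\<^sup>2, 2\<sigma>k)\<close> has argument \<open>2 arctan (\<sigma>/k)\<close>, so the secular equation states
  that \<open>sin\<close> vanishes at \<open>k - n\<pi> - 2 arctan (\<sigma>/k)\<close>. This number has absolute value below \<open>\<pi>\<close>.
\<close>

lemma phase_robin_k:
  assumes "0 < \<sigma>"
  shows "phase \<sigma> (robin_k n \<sigma>) = real n * pi"
proof -
  define k where "k = robin_k n \<sigma>"
  define t where "t = k - real n * pi"
  define \<alpha> where "\<alpha> = arctan (\<sigma> / k)"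
  have k: "0 < k" using robin_k_pos[OF assms] by (simp add: k_def)
  have t: "0 < t" "t < pi"
    using robin_k_bounds_and_secular[OF assms, of n] by (auto simp: t_def k_def algebra_simps)
  have \<alpha>: "0 < \<alpha>" "\<alpha> < pi / 2"
    using assms k arctan_ubound[of "\<sigma> / k"] by (simp_all add: \<alpha>_def)
  have "(k\<^sup>2 - \<sigma>\<^sup>2) * sin k = 2 * \<sigma> * k * cos k"
    using robin_k_bounds_and_secular(3)[OF assms, of n] robin_secular_iff[OF assms k]
    by (simp add: k_def)
  moreover have "sin k = (-1) ^ n * sin t" "cos k = (-1) ^ n * cos t"
    using sin_add[of t "real n * pi"] cos_add[of t "real n * pi"] by (simp_all add: t_def)
  ultimately have "(-1) ^ n * ((k\<^sup>2 - \<sigma>\<^sup>2) * sin t) = (-1) ^ n * (2 * \<sigma> * k * cos t)"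
    by (simp add: mult_ac)
  then have sec: "(k\<^sup>2 - \<sigma>\<^sup>2) * sin t = 2 * \<sigma> * k * cos t" by simp
  have "cos \<alpha> > 0" using \<alpha> by (simp add: cos_gt_zero)
  moreover have "tan \<alpha> = \<sigma> / k" by (simp add: \<alpha>_def tan_arctan)
  ultimately have s: "\<sigma> * cos \<alpha> = k * sin \<alpha>"
    using k by (simp add: tan_def field_simps)
  have "k\<^sup>2 * sin (t - 2 * \<alpha>) = (cos \<alpha>)\<^sup>2 * ((k\<^sup>2 - \<sigma>\<^sup>2) * sin t - 2 * \<sigma> * k * cos t)"
  proof -
    have "k\<^sup>2 * (x * (c\<^sup>2 - d\<^sup>2) - y * (2 * d * c))
        = ((k * c)\<^sup>2 - (k * d)\<^sup>2) * x - 2 * (k * d) * (k * c) * y" for c d x y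
      by (simp add: algebra_simps power2_eq_square)
    then have "k\<^sup>2 * sin (t - 2 * \<alpha>)
        = ((k * cos \<alpha>)\<^sup>2 - (k * sin \<alpha>)\<^sup>2) * sin t - 2 * (k * sin \<alpha>) * (k * cos \<alpha>) * cos t"
      by (simp only: sin_diff sin_double cos_double)
    also have "\<dots> = (cos \<alpha>)\<^sup>2 * ((k\<^sup>2 - \<sigma>\<^sup>2) * sin t - 2 * \<sigma> * k * cos t)"
      unfolding s[symmetric] by algebra
    finally show ?thesis .
  qed
  then have "sin (t - 2 * \<alpha>) = 0" using sec k by simp
  moreover have "- pi < t - 2 * \<alpha>" "t - 2 * \<alpha> < pi" using t \<alpha> by linarith+
  ultimately have "t - 2 * \<alpha> = 0" by (blast intro: sin_eq_0_pi)
  then show ?thesis unfolding phase_def t_def \<alpha>_def k_def by linarith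
qed

text \<open>
  With \<open>\<alpha> = arctan (\<sigma>/k)\<close> and \<open>n\<pi> = k - 2\<alpha>\<close>, the gap \<open>k\<^sup>2 - (n\<pi>)\<^sup>2\<close> is \<open>4\<alpha>k - 4\<alpha>\<^sup>2\<close>, and
  \<open>\<alpha> \<le> \<sigma>/k\<close> makes it at most \<open>4\<sigma>\<close>, uniformly in \<open>n\<close>.
\<close>

lemma robin_k_square_bounds:
  assumes "0 < \<sigma>"
  shows "pi\<^sup>2 * (real n)\<^sup>2 \<le> (robin_k n \<sigma>)\<^sup>2"
    and "(robin_k n \<sigma>)\<^sup>2 \<le> pi\<^sup>2 * (real n)\<^sup>2 + 4 * \<sigma>"
proof -
  define k where "k = robin_k n \<sigma>"
  define \<alpha> where "\<alpha> = arctan (\<sigma> / k)"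
  have k: "0 < k" using robin_k_pos[OF assms] by (simp add: k_def)
  have "(real n * pi)\<^sup>2 \<le> k\<^sup>2"
    using robin_k_bounds_and_secular(1)[OF assms, of n] by (intro power_mono) (auto simp: k_def)
  then show "pi\<^sup>2 * (real n)\<^sup>2 \<le> (robin_k n \<sigma>)\<^sup>2"
    by (simp add: k_def power_mult_distrib mult.commute)
  have "\<alpha> \<le> \<sigma> / k" using assms k by (simp add: \<alpha>_def arctan_bounds)
  then have "\<alpha> * k \<le> \<sigma>" using k by (simp add: field_simps)
  moreover have "real n * pi = k - 2 * \<alpha>"
    using phase_robin_k[OF assms, of n] by (simp add: phase_def k_def \<alpha>_def)
  then have "pi\<^sup>2 * (real n)\<^sup>2 = k\<^sup>2 - 4 * (\<alpha> * k) + 4 * \<alpha>\<^sup>2"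
    by (simp add: power_mult_distrib[symmetric] mult.commute[of pi] power2_diff)
  ultimately show "(robin_k n \<sigma>)\<^sup>2 \<le> pi\<^sup>2 * (real n)\<^sup>2 + 4 * \<sigma>"
    using zero_le_power2[of \<alpha>] unfolding k_def by linarith
qed

section \<open>Multiplicities on the square\<close>

text \<open>The total shift from the Neumann eigenvalue is at most \<open>8\<sigma>\<close>, less than the gap \<open>\<pi>\<^sup>2\<close> between Neumann levels.\<close>

lemma robin_square_eigenvalue_determines_sum_of_squares:
  assumes "0 < \<sigma>" "8 * \<sigma> < pi\<^sup>2"
    and eq: "robin_square_eigenvalue n m \<sigma> = robin_square_eigenvalue n' m' \<sigma>"
  shows "n\<^sup>2 + m\<^sup>2 = n'\<^sup>2 + m'\<^sup>2"
proof -
  have le: "b \<le> a"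
    if "pi\<^sup>2 * real b \<le> pi\<^sup>2 * real a + 8 * \<sigma>" for a b :: nat
  proof -
    have "pi\<^sup>2 * real b < pi\<^sup>2 * (real a + 1)"
      using that assms(2) by (simp add: algebra_simps)
    then show ?thesis by simp
  qed
  note bounds = robin_k_square_bounds[OF assms(1)]
  show ?thesis
  proof (rule antisym; rule le)
    show "pi\<^sup>2 * real (n\<^sup>2 + m\<^sup>2) \<le> pi\<^sup>2 * real (n'\<^sup>2 + m'\<^sup>2) + 8 * \<sigma>"
      "pi\<^sup>2 * real (n'\<^sup>2 + m'\<^sup>2) \<le> pi\<^sup>2 * real (n\<^sup>2 + m\<^sup>2) + 8 * \<sigma>"
      using bounds[of n] bounds[of m] bounds[of n'] bounds[of m'] eq
      by (simp_all add: robin_square_eigenvalue_def distrib_left)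
  qed
qed

text \<open>
  The larger of the two smaller indices must come with the smaller of the two larger ones, which
  nests the pairs.
\<close>

lemma robin_square_eigenvalue_nested_neq:
  assumes "0 < \<sigma>" "m' \<le> n'" "m < m'" "n\<^sup>2 + m\<^sup>2 = n'\<^sup>2 + m'\<^sup>2"
  shows "robin_square_eigenvalue n m \<sigma> \<noteq> robin_square_eigenvalue n' m' \<sigma>"
proof
  assume eq: "robin_square_eigenvalue n m \<sigma> = robin_square_eigenvalue n' m' \<sigma>"
  have "m\<^sup>2 < m'\<^sup>2" using assms(3) by (simp add: power_strict_mono)
  then have "n'\<^sup>2 < n\<^sup>2" using assms(4) by linarith
  then have "n' < n" by (rule power_less_imp_less_base) simp
  have "robin_k m' \<sigma> \<le> robin_k n' \<sigma>"
    using assms(2) robin_k_strict_mono[OF assms(1), of m' n'] by (cases "m' = n'") auto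
  then have "(phase \<sigma> (robin_k m' \<sigma>))\<^sup>2 - (phase \<sigma> (robin_k m \<sigma>))\<^sup>2
      < (phase \<sigma> (robin_k n \<sigma>))\<^sup>2 - (phase \<sigma> (robin_k n' \<sigma>))\<^sup>2"
    using eq assms(3) \<open>n' < n\<close>
    by (intro phase_square_increment_less)
       (auto simp: robin_square_eigenvalue_def robin_k_pos robin_k_strict_mono assms(1))
  then have "pi\<^sup>2 * (real (n'\<^sup>2 + m'\<^sup>2)) < pi\<^sup>2 * (real (n\<^sup>2 + m\<^sup>2))"
    by (simp add: phase_robin_k[OF assms(1)] power_mult_distrib algebra_simps)
  then show False using assms(4) by simp
qed

lemma robin_square_eigenvalue_inj_ordered:
  assumes "0 < \<sigma>" "8 * \<sigma> < pi\<^sup>2" "m \<le> n" "m' \<le> n'"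
    and eq: "robin_square_eigenvalue n m \<sigma> = robin_square_eigenvalue n' m' \<sigma>"
  shows "n = n' \<and> m = m'"
proof -
  have N: "n\<^sup>2 + m\<^sup>2 = n'\<^sup>2 + m'\<^sup>2"
    using robin_square_eigenvalue_determines_sum_of_squares[OF assms(1,2) eq] .
  have "\<not> m < m'" "\<not> m' < m"
    using robin_square_eigenvalue_nested_neq[OF assms(1,4) _ N]
      robin_square_eigenvalue_nested_neq[OF assms(1,3) _ N[symmetric]] eq by auto
  then have "m = m'" by simp
  then show ?thesis using N by simp
qed

theorem theorem1p1:
  shows "\<exists>\<sigma>\<^sub>0>0. \<forall>\<sigma>. 0 < \<sigma> \<and> \<sigma> < \<sigma>\<^sub>0 \<longrightarrow>
    (\<forall>n m n' m'.
       robin_square_eigenvalue n m \<sigma> = robin_square_eigenvalue n' m' \<sigma> \<longrightarrow>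
       (n', m') = (n, m) \<or> (n', m') = (m, n))"
proof (intro exI[of _ "pi\<^sup>2 / 8"] conjI allI impI)
  fix \<sigma> :: real and n m n' m' :: nat
  assume "0 < \<sigma> \<and> \<sigma> < pi\<^sup>2 / 8"
    and eq: "robin_square_eigenvalue n m \<sigma> = robin_square_eigenvalue n' m' \<sigma>"
  then have \<sigma>: "0 < \<sigma>" "8 * \<sigma> < pi\<^sup>2" by auto
  have sym: "robin_square_eigenvalue (max i j) (min i j) \<sigma> = robin_square_eigenvalue i j \<sigma>" for i j
    by (simp add: robin_square_eigenvalue_def max_def min_def)
  have "max n m = max n' m' \<and> min n m = min n' m'"
    using eq by (intro robin_square_eigenvalue_inj_ordered[OF \<sigma>]) (simp_all add: sym)
  then show "(n', m') = (n, m) \<or> (n', m') = (m, n)"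
    by (auto simp: max_def min_def split: if_splits)
qed simp

end
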